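(* Let $\mathcal{G}(\mathcal{V},\mathcal{E})$ be a connected, unweighted, undirected graph of order $n$ with Laplacian $\mathcal{L}$ and incidence matrix $\mathcal{B}\in\{-1,0,1\}^{n\times \ell}$ (with the convention in the context). For $i\in\{1,\dots,n\}$ let $z_i:[t_0,\infty)\to\mathbb{R}$ and $\mathbf{h}_i:[t_0,\infty)\to\mathbb{R}^2$ be the bearing-derived signals described in the context, and set $$\boldsymbol{\phi}_i(t)=\begin{bmatrix}\operatorname{vec}\left(\mathbf{h}_i(t)\mathbf{h}_i^\top(t)\right)\\ z_i(t)\mathbf{h}_i(t)\end{bmatrix}\in\mathbb{R}^6 .$$ Assume that the signals $z_i$ and $\mathbf{h}_i$ are bounded and continuously differentiable with bounded derivatives, and that $\gamma>0$ is a constant such that $\sup_{t\in[t_0,\infty)}\|\dot{\boldsymbol{\phi}}_i(t)\|_\infty\le\gamma<\infty$ for all $i\in\{1,\dots,n\}$. Let $\boldsymbol{\phi}(t)=[\boldsymbol{\phi}_1^\top(t)\ \cdots\ \boldsymbol{\phi}_n^\top(t)]^\top\in\mathbb{R}^{6n}$ and $\bar{\boldsymbol{\phi}}(t)=\frac1n\sum_{i=1}^n\boldsymbol{\phi}_i(t)$. Consider the dynamic average-consensus algorithm $$\dot{\mathbf{w}}(t)=-\beta\,(\mathcal{B}\otimes I_6)\,\mathrm{sgn}\left\{(\mathcal{B}^\top\otimes I_6)\,\mathbf{x}(t)\right\},\qquad \mathbf{x}(t)=\mathbf{w}(t)+\boldsymbol{\phi}(t),\qquad t\ge t_0,$$ with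 $\mathbf{w}(t),\mathbf{x}(t)\in\mathbb{R}^{6n}$, and let $\tilde{\mathbf{x}}(t)=\mathbf{x}(t)-\mathbf{1}_n\otimes\bar{\boldsymbol{\phi}}(t)$ be the average-consensus error. If $\mathbf{w}(t_0)=\mathbf{0}$ and $\beta$ is selected such that $$\beta\ \ge\ 1+\gamma\,\frac{\sqrt{\hat n}}{\hat\lambda_2},$$ where $\hat n$ and $\hat\lambda_2$ are positive constants with $\hat n\ge n$ and $\hat\lambda_2\le\lambda_2(\mathcal{L})$, then $\tilde{\mathbf{x}}$ is globally finite-time convergent: for every $\tilde{\mathbf{x}}(t_0)$, $\tilde{\mathbf{x}}(t)=\mathbf{0}$ for all $t\ge t^*$, where $$t^*=t_0+\frac{\|\tilde{\mathbf{x}}(t_0)\|_2}{\lambda_2(\mathcal{L})}.$$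
   Context: Graph conventions. $\mathcal{V}=\{v_1,\dots,v_n\}$, $n\ge 2$. Each undirected edge is regarded as two distinct directed edges (one in each direction), and $\mathcal{E}=\{e_1,\dots,e_\ell\}$ lists all these directed edges. The adjacency matrix is $\mathcal{A}=[a_{ij}]\in\{0,1\}^{n\times n}$ with $a_{ij}=1$ if $(v_i,v_j)\in\mathcal{E}$ and $a_{ij}=0$ otherwise; the graph is simple (no self-loops). The Laplacian is $\mathcal{L}=\mathrm{diag}(\mathcal{A}\mathbf{1}_n)-\mathcal{A}$. The incidence matrix $\mathcal{B}=[b_{ij}]\in\{-1,0,1\}^{n\times\ell}$ has $b_{ij}=-1$ if $e_j$ leaves $v_i$, $b_{ij}=1$ if $e_j$ enters $v_i$, and $b_{ij}=0$ otherwise. $\lambda_2(\mathcal{L})$ is the second-smallest eigenvalue of $\mathcal{L}$ (the algebraic connectivity). Notation. $\mathbf{1}_n$ is the all-ones vector in $\mathbb{R}^n$, $I_6$ the $6\times 6$ identity, $\otimes$ the Kronecker product, $\mathrm{sgn}\{\cdot\}$ the signum function applied componentwise, $\operatorname{vec}$ stacks the columns of a matrix into a vector, and $\|\cdot\|_p$ is the vector $p$-norm. Signals. There are $n$ stationary sensors at positions $\boldsymbol{s}_i\in\mathbb{R}^2$, and a target with position $\boldsymbol{p}(t)\in\mathbb{R}^2$, $\dot{\boldsymbol{p}}(t)=\mathbf{v}(t)$, with $\boldsymbol{p}(t)\neq \boldsymbol{s}_i$ so that bearings are defined. Sensor $i$ measures the bearing angle $\theta_i(t)\in[0,2\pi)$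 defined by $[\cos\theta_i(t)\ \ \sin\theta_i(t)]^\top=(\boldsymbol{p}(t)-\boldsymbol{s}_i)/\|\boldsymbol{p}(t)-\boldsymbol{s}_i\|_2$. Then $\mathbf{h}_i(t)=[-\sin\theta_i(t)\ \ \cos\theta_i(t)]^\top$ and $z_i(t)=\mathbf{h}_i^\top(t)\boldsymbol{s}_i$. Solutions. Because the right-hand side is discontinuous, solutions on $[t_0,\infty)$ are understood in the Filippov sense (locally absolutely continuous functions satisfying the associated Filippov differential inclusion for almost every $t$); the assertion concerns every such solution. *)

theory Defs
  imports
    "Graph_Theory.Digraph_Component"
    "HOL-Computational_Algebra.Polynomial"
    "HOL-Analysis.Analysis"
begin

text \<open>A simple undirected graph is a \<^locale>\<open>graph\<close> in which every undirected edge is a pair of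
  opposite arcs. When \<^prop>\<open>verts G = UNIV\<close> and \<^prop>\<open>arcs G = UNIV\<close>, the vertex and arc types
  serve as row and column indices of the graph matrices.\<close>

definition adjacency :: "('n::finite, 'l) pre_digraph \<Rightarrow> real^'n^'n" where
  "adjacency G = (\<chi> i j. if (i, j) \<in> arcs_ends G then 1 else 0)"

definition diag :: "real^'n \<Rightarrow> real^'n^'n" where
  "diag d = (\<chi> i j. if i = j then d $ i else 0)"

definition laplacian :: "('n::finite, 'l) pre_digraph \<Rightarrow> real^'n^'n" where
  "laplacian G = diag (adjacency G *v vec 1) - adjacency G"

definition incidence :: "('n::finite, 'l::finite) pre_digraph \<Rightarrow> real^'l^'n" where
  "incidence G = (\<chi> i e. if tail G e = i then -1 else if head G e = i then 1 else 0)"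

definition charpoly :: "real^'n^'n \<Rightarrow> real poly" where
  "charpoly A = det (\<chi> i j. (if i = j then [:0, 1:] else 0) - [:A $ i $ j:])"

text \<open>The real eigenvalues in increasing order, repeated according to their multiplicity as roots
  of the characteristic polynomial.\<close>

definition eigenvalues :: "real^'n^'n \<Rightarrow> real list" where
  "eigenvalues A = sorted_list_of_multiset (proots (charpoly A))"

definition lambda2 :: "real^'n^'n \<Rightarrow> real" where
  "lambda2 A = eigenvalues A ! 1"

text \<open>Kronecker products are indexed by pairs, the first component being the block index.\<close>

definition kron :: "real^'b^'a \<Rightarrow> real^'d^'c \<Rightarrow> real^('b \<times> 'd)^('a \<times> 'c)" where
  "kron A B = (\<chi> r c. A $ fst r $ fst c * B $ snd r $ snd c)"

definition kron_vec :: "real^'a \<Rightarrow> real^'c \<Rightarrow> real^('a \<times> 'c)" where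
  "kron_vec u v = (\<chi> r. u $ fst r * v $ snd r)"

definition stack :: "('n::finite \<Rightarrow> real^'m) \<Rightarrow> real^('n \<times> 'm)" where
  "stack f = (\<chi> r. f (fst r) $ snd r)"

text \<open>\<^const>\<open>sgn\<close> at a vector type would normalise the vector instead.\<close>

definition sgn_vec :: "real^'n \<Rightarrow> real^'n" where
  "sgn_vec x = (\<chi> i. sgn (x $ i))"

text \<open>The first four entries are the stacked columns of \<open>h h\<^sup>T\<close>.\<close>

definition regressor :: "real \<Rightarrow> real^2 \<Rightarrow> real^6" where
  "regressor z h =
    (let H = (columnvector h :: real^1^2) ** (rowvector h :: real^2^1)
     in vector [H $ 1 $ 1, H $ 2 $ 1, H $ 1 $ 2, H $ 2 $ 2, z * h $ 1, z * h $ 2])"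

text \<open>Derivatives are taken within \<open>S\<close>, hence one-sided at the endpoint of a half-line.\<close>

definition bounded_C1_on :: "(real \<Rightarrow> 'a::real_normed_vector) \<Rightarrow> real set \<Rightarrow> bool" where
  "bounded_C1_on f S \<longleftrightarrow> bounded (f ` S) \<and>
    (\<exists>f'. (\<forall>t\<in>S. (f has_vector_derivative f' t) (at t within S)) \<and>
          continuous_on S f' \<and> bounded (f' ` S))"

text \<open>Members of a division are closed intervals with disjoint interiors.\<close>

definition absolutely_continuous_on :: "real set \<Rightarrow> (real \<Rightarrow> 'a::real_normed_vector) \<Rightarrow> bool" where
  "absolutely_continuous_on S f \<longleftrightarrow>
    (\<forall>\<epsilon>>0. \<exists>\<delta>>0. \<forall>D T. D division_of T \<and> T \<subseteq> S \<and> (\<Sum>K\<in>D. Sup K - Inf K) < \<delta> \<longrightarrow>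
       (\<Sum>K\<in>D. norm (f (Sup K) - f (Inf K))) < \<epsilon>)"

definition filippov_map :: "(real \<Rightarrow> 'a \<Rightarrow> 'a) \<Rightarrow> real \<Rightarrow> 'a \<Rightarrow> 'a::euclidean_space set" where
  "filippov_map f t x =
    (\<Inter>\<delta>\<in>{0<..}. \<Inter>N\<in>{N. negligible N}. closure (convex hull (f t ` (ball x \<delta> - N))))"

definition filippov_solution ::
  "(real \<Rightarrow> 'a \<Rightarrow> 'a::euclidean_space) \<Rightarrow> real \<Rightarrow> (real \<Rightarrow> 'a) \<Rightarrow> bool" where
  "filippov_solution f t0 w \<longleftrightarrow>
    (\<forall>T\<ge>t0. absolutely_continuous_on {t0..T} w) \<and>
    (AE t in lebesgue. t \<ge> t0 \<longrightarrow>
       (\<exists>w'\<in>filippov_map f t (w t). (w has_vector_derivative w') (at t within {t0..})))"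

definition consensus_rhs ::
  "('n::finite, 'l::finite) pre_digraph \<Rightarrow> real \<Rightarrow> (real \<Rightarrow> real^('n \<times> 6)) \<Rightarrow>
   real \<Rightarrow> real^('n \<times> 6) \<Rightarrow> real^('n \<times> 6)" where
  "consensus_rhs G \<beta> \<Phi> t w =
    - \<beta> *\<^sub>R (kron (incidence G) (mat 1) *v
      sgn_vec (kron (transpose (incidence G)) (mat 1) *v (w + \<Phi> t)))"

end

theory Submission
  imports Defs
begin

text \<open>Let \<open>X\<close> be the consensus error, \<open>D\<close> the operator taking \<open>X\<close> to its differences along the arcs
  (so \<open>D = B\<^sup>T \<otimes> I\<close>), and \<open>b\<close> the sum of the absolute values of the entries of \<open>D X\<close>. The proof is a
  Lyapunov argument whose Lyapunov function is the Euclidean norm of \<open>X\<close>.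

  The right-hand side is \<open>- \<beta> D\<^sup>T sgn (D x)\<close>. Near \<open>x\<close> the entries of \<open>D x\<close> that do not vanish keep
  their signs, so pairing the vector field with \<open>x\<close> gives \<open>- \<beta> b\<close> on a whole neighbourhood, whatever
  the signs of the other entries. A linear equation of this kind survives closed convex hulls, so every
  element of the Filippov set satisfies it; this is \<open>filippov_consensus_dissipation\<close>. In the same way
  pairing with a vector in the kernel of \<open>D\<close> gives 0 (\<open>filippov_consensus_conserves\<close>). Hence the sum of
  \<open>w\<close> over the sensors keeps its initial value 0, and \<open>X\<close> stays orthogonal to the consensus directions.

  On vectors of sum zero the Laplacian expands norms by at least \<open>\<lambda>\<^sub>2\<close>, and each entry of \<open>L y\<close> is a sum
  of differences along arcs. Therefore \<open>\<lambda>\<^sub>2 \<parallel>X\<parallel>\<^sub>2 \<le> b\<close>, and by Cauchy--Schwarz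
  \<open>\<lambda>\<^sub>2 \<parallel>X\<parallel>\<^sub>1 \<le> \<surd>n b\<close> (\<open>edge_variation_bounds\<close>). Since \<open>X\<close> has sum zero, the drift of the average
  is orthogonal to it, and the drift of the signals contributes at most
  \<open>\<gamma> \<parallel>X\<parallel>\<^sub>1 \<le> \<gamma> (\<surd>n / \<lambda>\<^sub>2) b\<close>. The gain condition leaves
  \<open>X \<bullet> X' \<le> - b \<le> - \<lambda>\<^sub>2 \<parallel>X\<parallel>\<^sub>2\<close>, that is, the norm of \<open>X\<close> decreases at rate at least \<open>\<lambda>\<^sub>2\<close> while it is
  positive (\<open>consensus_error_dissipation\<close>, \<open>finite_time_extinction\<close>).

  Two general facts support this. An absolutely continuous function whose derivative is almost
  everywhere nonpositive is nonincreasing (\<open>absolutely_continuous_nonincreasing\<close>). And the second entry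
  of the sorted list of eigenvalues of \<open>L\<close> is at most the minimum of the Rayleigh quotient on vectors of
  sum zero (\<open>lambda2_laplacian_le_rayleigh\<close>): by connectivity this minimum is a positive eigenvalue,
  while 0 is an eigenvalue too.\<close>

section \<open>Absolutely continuous functions of a real variable\<close>

lemma division_of_real_member:
  fixes K :: "real set"
  assumes "D division_of T" "K \<in> D"
  obtains u v where "K = {u..v}" "u \<le> v" "Inf K = u" "Sup K = v" "u \<in> T" "v \<in> T"
proof -
  obtain u v where K: "K = cbox u v" and ne: "K \<noteq> {}" and sub: "K \<subseteq> T"
    using division_ofD(2,3,4)[OF assms(1)] assms(2) by metis
  then have "u \<le> v" by simp
  then have "u \<in> K" "v \<in> K" using K by auto
  with sub have "u \<in> T" "v \<in> T" by auto
  with \<open>u \<le> v\<close> K show ?thesis using that[of u v] by simp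
qed

text \<open>Absolute continuity passes from \<open>f\<close> to any function whose increments are controlled by those of
  \<open>f\<close> and a Lipschitz term. This one criterion covers norms, inner products and Lipschitz
  perturbations of a Filippov solution.\<close>

lemma absolutely_continuous_on_bounded_increments:
  fixes f :: "real \<Rightarrow> 'a::real_normed_vector" and g :: "real \<Rightarrow> 'b::real_normed_vector"
  assumes ac: "absolutely_continuous_on S f" and "T \<subseteq> S" and "C \<ge> 0" "B \<ge> 0"
    and bound: "\<And>u v. \<lbrakk>u \<in> T; v \<in> T; u \<le> v\<rbrakk> \<Longrightarrow>
      norm (g v - g u) \<le> C * norm (f v - f u) + B * (v - u)"
  shows "absolutely_continuous_on T g"
  unfolding absolutely_continuous_on_def
proof (intro allI impI)
  fix e :: real assume "e > 0"
  then have "e / (2 * (C + 1)) > 0" using \<open>C \<ge> 0\<close> by simp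
  then obtain d where "d > 0" and d: "\<And>D U. \<lbrakk>D division_of U; U \<subseteq> S; (\<Sum>K\<in>D. Sup K - Inf K) < d\<rbrakk> \<Longrightarrow>
      (\<Sum>K\<in>D. norm (f (Sup K) - f (Inf K))) < e / (2 * (C + 1))"
    using ac unfolding absolutely_continuous_on_def by meson
  define d' where "d' = min d (e / (2 * (B + 1)))"
  have "d' > 0" using \<open>d > 0\<close> \<open>e > 0\<close> \<open>B \<ge> 0\<close> by (simp add: d'_def)
  moreover have "(\<Sum>K\<in>D. norm (g (Sup K) - g (Inf K))) < e"
    if D: "D division_of U" "U \<subseteq> T" "(\<Sum>K\<in>D. Sup K - Inf K) < d'" for D U
  proof -
    let ?F = "\<Sum>K\<in>D. norm (f (Sup K) - f (Inf K))" and ?L = "\<Sum>K\<in>D. Sup K - Inf K"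
    have "(\<Sum>K\<in>D. norm (g (Sup K) - g (Inf K)))
        \<le> (\<Sum>K\<in>D. C * norm (f (Sup K) - f (Inf K)) + B * (Sup K - Inf K))"
    proof (rule sum_mono)
      fix K assume "K \<in> D"
      then obtain u v where "u \<le> v" "Inf K = u" "Sup K = v" "u \<in> U" "v \<in> U"
        using division_of_real_member[OF D(1)] by metis
      then show "norm (g (Sup K) - g (Inf K)) \<le> C * norm (f (Sup K) - f (Inf K)) + B * (Sup K - Inf K)"
        using bound D(2) by auto
    qed
    also have "\<dots> = C * ?F + B * ?L"
      by (simp add: sum.distrib sum_distrib_left)
    also have "\<dots> < e"
    proof -
      have F: "?F < e / (2 * (C + 1))" using d[OF D(1)] D(2,3) \<open>T \<subseteq> S\<close> by (auto simp: d'_def)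
      have L: "?L < e / (2 * (B + 1))" using D(3) by (simp add: d'_def)
      have "C * ?F \<le> C * (e / (2 * (C + 1)))" using F \<open>C \<ge> 0\<close> by (intro mult_left_mono) auto
      also have "\<dots> < e / 2" using \<open>C \<ge> 0\<close> \<open>e > 0\<close> by (simp add: field_simps)
      finally have 1: "C * ?F < e / 2" .
      have "B * ?L \<le> B * (e / (2 * (B + 1)))" using L \<open>B \<ge> 0\<close> by (intro mult_left_mono) auto
      also have "\<dots> < e / 2" using \<open>B \<ge> 0\<close> \<open>e > 0\<close> by (simp add: field_simps)
      finally show ?thesis using 1 by simp
    qed
    finally show ?thesis .
  qed
  ultimately show "\<exists>d>0. \<forall>D U. D division_of U \<and> U \<subseteq> T \<and> (\<Sum>K\<in>D. Sup K - Inf K) < d \<longrightarrow>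
      (\<Sum>K\<in>D. norm (g (Sup K) - g (Inf K))) < e"
    by blast
qed

lemma absolutely_continuous_imp_continuous:
  fixes f :: "real \<Rightarrow> 'a::real_normed_vector"
  assumes ac: "absolutely_continuous_on {a..b} f"
  shows "continuous_on {a..b} f"
  unfolding continuous_on_iff
proof (intro ballI allI impI)
  fix s and e :: real assume s: "s \<in> {a..b}" and "e > 0"
  then obtain d where "d > 0" and d: "\<And>D U. \<lbrakk>D division_of U; U \<subseteq> {a..b}; (\<Sum>K\<in>D. Sup K - Inf K) < d\<rbrakk> \<Longrightarrow>
      (\<Sum>K\<in>D. norm (f (Sup K) - f (Inf K))) < e"
    using ac unfolding absolutely_continuous_on_def by meson
  have close: "norm (f v - f u) < e" if "u \<in> {a..b}" "v \<in> {a..b}" "u \<le> v" "v - u < d" for u v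
    using d[of "{{u..v}}" "{u..v}"] division_of_self[of u v] that by auto
  have "dist (f r) (f s) < e" if "r \<in> {a..b}" "dist r s < d" for r
    using close[of r s] close[of s r] s that by (cases "r \<le> s") (auto simp: dist_norm norm_minus_commute)
  with \<open>d > 0\<close> show "\<exists>d>0. \<forall>r\<in>{a..b}. dist r s < d \<longrightarrow> dist (f r) (f s) < e" by blast
qed

text \<open>The straddle form of the derivative bound: both endpoints vary, on opposite sides of \<open>t\<close>. This is
  what the intervals of a fine tagged division provide.\<close>

lemma increment_bound_of_nonpos_derivative:
  fixes g :: "real \<Rightarrow> real"
  assumes g: "(g has_real_derivative g') (at t within S)" and "g' \<le> 0" "e > 0"
  obtains d where "d > 0"
    "\<And>u v. \<lbrakk>u \<in> S; v \<in> S; u \<le> t; t \<le> v; t - u < d; v - t < d\<rbrakk> \<Longrightarrow> g v - g u \<le> e * (v - u)"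
proof -
  from g have "(g has_derivative (\<lambda>x. x * g')) (at t within S)"
    by (simp add: has_field_derivative_def mult.commute[of g'] mult_commute_abs)
  then obtain d where "d > 0" and
    d: "\<And>y. \<lbrakk>y \<in> S; norm (y - t) < d\<rbrakk> \<Longrightarrow> norm (g y - g t - (y - t) * g') \<le> e * norm (y - t)"
    using \<open>e > 0\<close> unfolding has_derivative_within_alt by blast
  have "g v - g u \<le> e * (v - u)"
    if "u \<in> S" "v \<in> S" "u \<le> t" "t \<le> v" "t - u < d" "v - t < d" for u v
  proof -
    have "\<bar>g v - g t - (v - t) * g'\<bar> \<le> e * (v - t)" using d[of v] that by simp
    moreover have "\<bar>g u - g t - (u - t) * g'\<bar> \<le> e * (t - u)" using d[of u] that by simp
    moreover have "(v - t) * g' - (u - t) * g' \<le> 0"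
      using \<open>g' \<le> 0\<close> that by (simp add: left_diff_distrib[symmetric] mult_nonneg_nonpos)
    ultimately have "g v - g u \<le> e * (v - t) + e * (t - u)" by linarith
    then show ?thesis by (simp add: algebra_simps)
  qed
  with \<open>d > 0\<close> show ?thesis using that by blast
qed

text \<open>Choose an open \<open>U\<close> containing the exceptional set \<open>E\<close>, of measure below the modulus of absolute
  continuity, and a gauge that keeps intervals tagged in \<open>E\<close> inside \<open>U\<close> and the other ones where the
  straddle estimate holds. In a fine tagged division the intervals tagged outside \<open>E\<close> increase \<open>g\<close> by
  at most a small multiple of their length, and those tagged in \<open>E\<close> have small total length.\<close>

lemma absolutely_continuous_nonincreasing:
  fixes g :: "real \<Rightarrow> real"
  assumes "a \<le> b" and ac: "absolutely_continuous_on {a..b} g" and "negligible E"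
    and deriv: "\<And>t. t \<in> {a..b} - E \<Longrightarrow> \<exists>g'\<le>0. (g has_real_derivative g') (at t within {a..b})"
  shows "g b \<le> g a"
proof -
  have "g b - g a \<le> e" if "e > 0" for e
  proof -
    define \<eta> where "\<eta> = e / (2 * (b - a + 1))"
    have "\<eta> > 0" using \<open>a \<le> b\<close> \<open>e > 0\<close> by (simp add: \<eta>_def)
    obtain \<delta> where "\<delta> > 0" and \<delta>: "\<And>D T. \<lbrakk>D division_of T; T \<subseteq> {a..b}; (\<Sum>K\<in>D. Sup K - Inf K) < \<delta>\<rbrakk> \<Longrightarrow>
        (\<Sum>K\<in>D. norm (g (Sup K) - g (Inf K))) < e / 2"
      using ac \<open>e > 0\<close> unfolding absolutely_continuous_on_def by (metis half_gt_zero)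
    have E: "E \<in> null_sets lebesgue" using \<open>negligible E\<close> by (simp add: negligible_iff_null_sets)
    then obtain U where U: "open U" "E \<subseteq> U" "(U - E) \<in> lmeasurable" "emeasure lebesgue (U - E) < ennreal \<delta>"
      using sets_lebesgue_outer_open[of E \<delta>] \<open>\<delta> > 0\<close> by (metis null_setsD2)
    have Ulm: "U \<in> lmeasurable"
    proof -
      have "U = (U - E) \<union> E" using U(2) by blast
      moreover have "E \<in> lmeasurable" using E by (simp add: null_sets_def fmeasurable_def)
      ultimately show ?thesis using U(3) fmeasurable.Un by metis
    qed
    have Um: "measure lebesgue U < \<delta>"
    proof -
      have "emeasure lebesgue U = emeasure lebesgue (U - E)"
        using emeasure_Diff_null_set[OF E, of U] Ulm by (simp add: fmeasurableD)
      then show ?thesis using U(4) \<open>\<delta> > 0\<close> Ulm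
        by (metis emeasure_eq_measure2 ennreal_less_iff measure_nonneg)
    qed
    have "\<exists>d>0. \<forall>u v. u \<in> {a..b} \<and> v \<in> {a..b} \<and> u \<le> t \<and> t \<le> v \<and> t - u < d \<and> v - t < d
        \<longrightarrow> g v - g u \<le> \<eta> * (v - u)" if "t \<in> {a..b} - E" for t
      using deriv[OF that] increment_bound_of_nonpos_derivative \<open>\<eta> > 0\<close> by metis
    then obtain d where d: "\<And>t. t \<in> {a..b} - E \<Longrightarrow> d t > 0"
      "\<And>t u v. \<lbrakk>t \<in> {a..b} - E; u \<in> {a..b}; v \<in> {a..b}; u \<le> t; t \<le> v; t - u < d t; v - t < d t\<rbrakk>
        \<Longrightarrow> g v - g u \<le> \<eta> * (v - u)"
      by metis
    define \<Gamma> where "\<Gamma> t = (if t \<in> E then U else if t \<in> {a..b} then ball t (d t) else UNIV)" for t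
    have "gauge \<Gamma>"
      using U(1,2) d(1) unfolding gauge_def \<Gamma>_def by auto
    then obtain p where p: "p tagged_division_of {a..b}" and fine: "\<Gamma> fine p"
      using fine_division_exists_real by blast
    note pD = tagged_division_ofD[OF p]
    define p1 where "p1 = {q \<in> p. fst q \<in> E}"
    define p2 where "p2 = {q \<in> p. fst q \<notin> E}"
    have fin: "finite p1" "finite p2" and p12: "p = p1 \<union> p2" "p1 \<inter> p2 = {}"
      using pD(1) by (auto simp: p1_def p2_def)
    have iv: "\<exists>u v. K = {u..v} \<and> Inf K = u \<and> Sup K = v \<and> u \<le> t \<and> t \<le> v \<and> a \<le> u \<and> v \<le> b"
      if tK: "(t, K) \<in> p" for t K
    proof -
      obtain u v where "K = cbox u v" using pD(4)[OF tK] by blast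
      moreover have "t \<in> K" "K \<subseteq> {a..b}" using pD(2,3) tK by auto
      ultimately show ?thesis by (intro exI[of _ u] exI[of _ v]) auto
    qed
    let ?G = "\<lambda>(t::real, K). g (Sup K) - g (Inf K)"
    have good: "sum ?G p2 \<le> e / 2"
    proof -
      have "sum ?G p2 \<le> (\<Sum>(t, K)\<in>p2. \<eta> * (Sup K - Inf K))"
      proof (intro sum_mono, clarify)
        fix t K assume tK: "(t, K) \<in> p2"
        then have "(t, K) \<in> p" "t \<notin> E" by (auto simp: p2_def)
        then obtain u v where uv: "K = {u..v}" "Inf K = u" "Sup K = v" "u \<le> t" "t \<le> v" "a \<le> u" "v \<le> b"
          using iv[OF \<open>(t, K) \<in> p\<close>] by blast
        have "K \<subseteq> ball t (d t)"
          using fine \<open>(t, K) \<in> p\<close> \<open>t \<notin> E\<close> uv unfolding fine_def \<Gamma>_def by fastforce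
        moreover have "u \<in> K" "v \<in> K" using uv by auto
        ultimately have "u \<in> ball t (d t)" "v \<in> ball t (d t)" by blast+
        then have "t - u < d t" "v - t < d t" using uv by (auto simp: dist_real_def)
        then show "g (Sup K) - g (Inf K) \<le> \<eta> * (Sup K - Inf K)"
          using d(2)[of t u v] uv \<open>t \<notin> E\<close> by auto
      qed
      also have "\<dots> \<le> (\<Sum>(t, K)\<in>p. \<eta> * (Sup K - Inf K))"
      proof (rule sum_mono2)
        show "finite p" "p2 \<subseteq> p" using pD(1) by (auto simp: p2_def)
        fix q assume "q \<in> p - p2"
        then obtain t K where q: "q = (t, K)" "(t, K) \<in> p" by (cases q) auto
        then show "0 \<le> (case q of (t, K) \<Rightarrow> \<eta> * (Sup K - Inf K))"
          using iv[of t K] \<open>\<eta> > 0\<close> by auto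
      qed
      also have "\<dots> = \<eta> * (\<Sum>(t, K)\<in>p. Sup K - Inf K)"
        by (simp add: sum_distrib_left case_prod_unfold)
      also have "\<dots> = \<eta> * (b - a)"
        using additive_tagged_division_1[OF \<open>a \<le> b\<close> p, of "\<lambda>x. x"] by simp
      also have "\<dots> \<le> e / 2"
        using \<open>a \<le> b\<close> \<open>e > 0\<close> by (simp add: \<eta>_def field_simps)
      finally show ?thesis .
    qed
    have bad: "sum ?G p1 \<le> e / 2"
    proof -
      define D where "D = snd ` p1"
      have "p1 tagged_partial_division_of {a..b}"
        using p tagged_partial_division_subset[of p "{a..b}" p1]
        unfolding tagged_division_of_def p1_def by blast
      then have p1: "p1 tagged_division_of \<Union>D"
        unfolding D_def by (rule tagged_partial_division_of_Union_self)
      then have D: "D division_of \<Union>D" unfolding D_def by (rule division_of_tagged_division)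
      have Dab: "\<Union>D \<subseteq> {a..b}" using pD(3) by (fastforce simp: D_def p1_def)
      have DU: "\<Union>D \<subseteq> U" using fine by (fastforce simp: D_def p1_def fine_def \<Gamma>_def)
      have "(\<Sum>K\<in>D. Sup K - Inf K) = (\<Sum>K\<in>D. measure lebesgue K)"
      proof (rule sum.cong[OF refl])
        fix K assume "K \<in> D"
        then obtain u v where "K = {u..v}" "u \<le> v" "Inf K = u" "Sup K = v"
          using division_of_real_member[OF D] by metis
        then show "Sup K - Inf K = measure lebesgue K" by simp
      qed
      also have "\<dots> = measure lebesgue (\<Union>D)"
        using content_division[OF D] by simp
      also have "\<dots> \<le> measure lebesgue U"
        using DU Ulm lmeasurable_division[OF D] by (intro measure_mono_fmeasurable) (auto simp: fmeasurableD)
      finally have small: "(\<Sum>K\<in>D. Sup K - Inf K) < \<delta>" using Um by simp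
      (* The sum over tagged intervals becomes a sum over intervals only for a function that vanishes
         on all degenerate intervals, the empty one included, where Sup and Inf are arbitrary. *)
      define h where "h K = (if K = {} then 0 else \<bar>g (Sup K) - g (Inf K)\<bar>)" for K
      have "sum ?G p1 \<le> (\<Sum>(t, K)\<in>p1. h K)"
      proof (intro sum_mono, clarify)
        fix t K assume "(t, K) \<in> p1"
        then have "K \<noteq> {}" using pD(2) by (auto simp: p1_def)
        then show "g (Sup K) - g (Inf K) \<le> h K" by (simp add: h_def)
      qed
      also have "\<dots> = sum h D"
        unfolding D_def
      proof (rule sum.over_tagged_division_lemma[OF p1])
        fix u v :: real assume "box u v = {}"
        then show "h (cbox u v) = 0" by (cases "u = v") (auto simp: h_def)
      qed
      also have "\<dots> = (\<Sum>K\<in>D. norm (g (Sup K) - g (Inf K)))"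
        using division_ofD(3)[OF D] by (intro sum.cong) (auto simp: h_def)
      also have "\<dots> < e / 2" using \<delta>[OF D Dab small] .
      finally show ?thesis by simp
    qed
    have "g b - g a = sum ?G p" using additive_tagged_division_1[OF \<open>a \<le> b\<close> p, of g] by simp
    also have "\<dots> = sum ?G p1 + sum ?G p2"
      unfolding p12(1) using fin p12(2) by (rule sum.union_disjoint)
    finally show ?thesis using good bad by simp
  qed
  then have "g b - g a \<le> 0" by (rule field_le_epsilon[where y=0, simplified])
  then show ?thesis by simp
qed

lemma has_real_derivative_norm_compose:
  fixes X :: "real \<Rightarrow> 'a::real_inner"
  assumes X: "(X has_vector_derivative X') (at s within S)" and "X s \<noteq> 0"
  shows "((\<lambda>r. norm (X r)) has_real_derivative (X s \<bullet> X') / norm (X s)) (at s within S)"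
proof -
  have "((\<lambda>r. norm (X r)) has_derivative (\<lambda>r. r *\<^sub>R X' \<bullet> sgn (X s))) (at s within S)"
    using has_derivative_compose[OF X[unfolded has_vector_derivative_def] has_derivative_norm[OF \<open>X s \<noteq> 0\<close>]]
    by (simp add: inner_commute)
  moreover have "(\<lambda>r. r *\<^sub>R X' \<bullet> sgn (X s)) = (*) ((X s \<bullet> X') / norm (X s))"
    by (simp add: fun_eq_iff sgn_div_norm inner_commute divide_inverse mult_ac)
  ultimately show ?thesis by (simp add: has_field_derivative_def)
qed

text \<open>At a zero of \<open>X\<close> the norm need not be differentiable, so the estimate is integrated only from the
  last time \<open>a\<close> before \<open>t\<close> at which \<open>X\<close> vanishes (or from \<open>t0\<close>). A nonzero value at \<open>t\<close> would then
  contradict the decrease of the norm at rate \<open>c\<close> on \<open>[a, t]\<close>.\<close>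

lemma finite_time_extinction:
  fixes X :: "real \<Rightarrow> 'a::real_inner"
  assumes ac: "\<And>T. T \<ge> t0 \<Longrightarrow> absolutely_continuous_on {t0..T} X"
    and "negligible E" and "c > 0"
    and decay: "\<And>t. \<lbrakk>t \<ge> t0; t \<notin> E\<rbrakk> \<Longrightarrow>
      \<exists>X'. (X has_vector_derivative X') (at t within {t0..}) \<and> X t \<bullet> X' \<le> - c * norm (X t)"
    and t: "t \<ge> t0 + norm (X t0) / c"
  shows "X t = 0"
proof (rule ccontr)
  assume "X t \<noteq> 0"
  have "norm (X t0) / c \<ge> 0" using \<open>c > 0\<close> by simp
  then have "t0 \<le> t" using t by linarith
  define Z where "Z = {t0} \<union> ({t0..t} \<inter> X -` {0})"
  have "closed ({t0..t} \<inter> X -` {0})"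
    using absolutely_continuous_imp_continuous[OF ac[OF \<open>t0 \<le> t\<close>]]
    by (intro continuous_closed_preimage) auto
  then have "compact Z"
    unfolding Z_def by (intro compact_Un) (auto simp: compact_eq_bounded_closed intro: bounded_subset[of "{t0..t}"])
  moreover have "Z \<noteq> {}" by (simp add: Z_def)
  ultimately obtain a where "a \<in> Z" and last: "\<And>s. s \<in> Z \<Longrightarrow> s \<le> a"
    using compact_attains_sup[of Z] by blast
  have a: "t0 \<le> a" "a \<le> t" using \<open>a \<in> Z\<close> \<open>t0 \<le> t\<close> by (auto simp: Z_def)
  define g where "g s = norm (X s) + c * s" for s
  have "g t \<le> g a"
  proof (rule absolutely_continuous_nonincreasing[of a t g "insert a E"])
    show "negligible (insert a E)" using \<open>negligible E\<close> by simp
    show "absolutely_continuous_on {a..t} g"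
    proof (rule absolutely_continuous_on_bounded_increments[OF ac[OF \<open>t0 \<le> t\<close>], where C = 1 and B = c])
      fix u v assume "u \<in> {a..t}" "v \<in> {a..t}" "u \<le> v"
      have "\<bar>g v - g u\<bar> \<le> \<bar>norm (X v) - norm (X u)\<bar> + \<bar>c * (v - u)\<bar>"
        unfolding g_def by (simp add: right_diff_distrib)
      also have "\<dots> \<le> norm (X v - X u) + c * (v - u)"
        using norm_triangle_ineq3[of "X v" "X u"] \<open>c > 0\<close> \<open>u \<le> v\<close> by (simp add: abs_mult)
      finally show "norm (g v - g u) \<le> 1 * norm (X v - X u) + c * (v - u)" by simp
    qed (use a \<open>c > 0\<close> in auto)
    fix s assume s: "s \<in> {a..t} - insert a E"
    then have "X s \<noteq> 0" using last[of s] a by (fastforce simp: Z_def)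
    obtain X' where X': "(X has_vector_derivative X') (at s within {t0..})" "X s \<bullet> X' \<le> - c * norm (X s)"
      using decay[of s] s a by auto
    have "(X has_vector_derivative X') (at s within {a..t})"
      using X'(1) by (rule has_vector_derivative_within_subset) (use a in auto)
    from has_real_derivative_norm_compose[OF this \<open>X s \<noteq> 0\<close>]
    have "(g has_real_derivative (X s \<bullet> X') / norm (X s) + c) (at s within {a..t})"
      unfolding g_def by (auto intro!: derivative_eq_intros)
    moreover have "(X s \<bullet> X') / norm (X s) + c \<le> 0"
      using X'(2) \<open>X s \<noteq> 0\<close> by (simp add: divide_simps)
    ultimately show "\<exists>g'\<le>0. (g has_real_derivative g') (at s within {a..t})" by blast
  qed (use a in auto)
  then have bound: "norm (X t) \<le> norm (X a) - c * (t - a)" by (simp add: g_def right_diff_distrib)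
  have "norm (X a) \<le> c * (t - a)"
  proof (cases "X a = 0")
    case False
    then have "a = t0" using \<open>a \<in> Z\<close> by (auto simp: Z_def)
    then show ?thesis using t \<open>c > 0\<close> by (simp add: field_simps)
  qed (use a \<open>c > 0\<close> in auto)
  with bound have "norm (X t) \<le> 0" by linarith
  then show False using \<open>X t \<noteq> 0\<close> by simp
qed

section \<open>Filippov solutions\<close>

lemma filippov_map_subset:
  assumes "\<delta> > 0" "closed C" "convex C" "\<And>y. y \<in> ball x \<delta> \<Longrightarrow> f t y \<in> C"
  shows "filippov_map f t x \<subseteq> C"
proof -
  have "filippov_map f t x \<subseteq> closure (convex hull (f t ` (ball x \<delta> - {})))"
    unfolding filippov_map_def using \<open>\<delta> > 0\<close> negligible_empty by blast
  also have "\<dots> \<subseteq> C"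
    using assms by (intro closure_minimal hull_minimal) auto
  finally show ?thesis .
qed

text \<open>Hyperplanes are closed and convex, so a linear equation satisfied by the field near \<open>x\<close> is
  inherited by the whole Filippov set.\<close>

lemma filippov_map_inner_eq:
  assumes "\<delta> > 0" "\<And>y. y \<in> ball x \<delta> \<Longrightarrow> a \<bullet> f t y = c" and "u \<in> filippov_map f t x"
  shows "a \<bullet> u = c"
proof -
  have "filippov_map f t x \<subseteq> {v. a \<bullet> v = c}"
    by (rule filippov_map_subset[OF assms(1) closed_hyperplane convex_hyperplane]) (simp add: assms(2))
  with assms(3) show ?thesis by blast
qed

lemma filippov_solutionE:
  assumes "filippov_solution f t0 w"
  obtains E where "negligible E"
    "\<And>t. \<lbrakk>t \<ge> t0; t \<notin> E\<rbrakk> \<Longrightarrow> \<exists>u\<in>filippov_map f t (w t). (w has_vector_derivative u) (at t within {t0..})"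
proof -
  have "AE t in lebesgue. t \<ge> t0 \<longrightarrow>
       (\<exists>u\<in>filippov_map f t (w t). (w has_vector_derivative u) (at t within {t0..}))"
    using assms by (simp add: filippov_solution_def)
  then obtain N where "N \<in> null_sets lebesgue"
    "{t \<in> space lebesgue. \<not> (t \<ge> t0 \<longrightarrow>
       (\<exists>u\<in>filippov_map f t (w t). (w has_vector_derivative u) (at t within {t0..})))} \<subseteq> N"
    by (auto simp: eventually_ae_filter)
  then show ?thesis by (intro that[of N]) (auto simp: negligible_iff_null_sets)
qed

text \<open>Both \<open>a \<bullet> w\<close> and its negative have derivative 0 almost everywhere, hence both are nonincreasing.\<close>

lemma filippov_solution_conserves:
  assumes w: "filippov_solution f t0 w"
    and orth: "\<And>t u. u \<in> filippov_map f t (w t) \<Longrightarrow> a \<bullet> u = 0" and "t \<ge> t0"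
  shows "a \<bullet> w t = a \<bullet> w t0"
proof -
  obtain E where "negligible E" and E: "\<And>t. \<lbrakk>t \<ge> t0; t \<notin> E\<rbrakk> \<Longrightarrow>
      \<exists>u\<in>filippov_map f t (w t). (w has_vector_derivative u) (at t within {t0..})"
    using filippov_solutionE[OF w] by metis
  have le: "(s *\<^sub>R a) \<bullet> w t \<le> (s *\<^sub>R a) \<bullet> w t0" for s
  proof (rule absolutely_continuous_nonincreasing[OF \<open>t \<ge> t0\<close> _ \<open>negligible E\<close>])
    show "absolutely_continuous_on {t0..t} (\<lambda>r. (s *\<^sub>R a) \<bullet> w r)"
    proof (rule absolutely_continuous_on_bounded_increments[where f = w and S = "{t0..t}" and C = "norm (s *\<^sub>R a)" and B = 0])
      show "absolutely_continuous_on {t0..t} w" using w \<open>t \<ge> t0\<close> by (simp add: filippov_solution_def)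
      fix u v
      show "norm ((s *\<^sub>R a) \<bullet> w v - (s *\<^sub>R a) \<bullet> w u) \<le> norm (s *\<^sub>R a) * norm (w v - w u) + 0 * (v - u)"
        using Cauchy_Schwarz_ineq2[of "s *\<^sub>R a" "w v - w u"] by (simp add: inner_diff_right)
    qed auto
    fix r assume "r \<in> {t0..t} - E"
    then obtain u where u: "u \<in> filippov_map f r (w r)" "(w has_vector_derivative u) (at r within {t0..})"
      using E[of r] by auto
    have "(w has_vector_derivative u) (at r within {t0..t})"
      using u(2) by (rule has_vector_derivative_within_subset) auto
    then have "((\<lambda>r. (s *\<^sub>R a) \<bullet> w r) has_vector_derivative (s *\<^sub>R a) \<bullet> u) (at r within {t0..t})"
      by (rule bounded_linear.has_vector_derivative[OF bounded_linear_inner_right])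
    then show "\<exists>g'\<le>0. ((\<lambda>r. (s *\<^sub>R a) \<bullet> w r) has_real_derivative g') (at r within {t0..t})"
      using orth[OF u(1)] by (auto simp: has_real_derivative_iff_has_vector_derivative)
  qed
  from le[of 1] le[of "-1"] show ?thesis by simp
qed

section \<open>Algebraic connectivity and the Rayleigh quotient\<close>

lemma mat_mult_vec: "mat c *v x = c *\<^sub>R (x :: real^'n)"
  by (simp add: vec_eq_iff matrix_vector_mult_def mat_def if_distrib[where f="\<lambda>a. a * _"] cong: if_cong)

lemma poly_charpoly: "poly (charpoly A) x = det (mat x - A)"
  unfolding charpoly_def det_def
  by (simp add: poly_sum poly_prod mat_def cong: if_cong)
    (intro sum.cong refl arg_cong2[where f="(*)"] prod.cong, auto)

lemma det_eq_0_iff_kernel: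
  fixes A :: "real^'n^'n"
  shows "det A = 0 \<longleftrightarrow> (\<exists>x. x \<noteq> 0 \<and> A *v x = 0)"
  using invertible_det_nz[of A] matrix_left_invertible_ker[of A]
  by (metis invertible_left_inverse)

lemma poly_charpoly_eq_0_iff:
  "poly (charpoly A) \<mu> = 0 \<longleftrightarrow> (\<exists>x. x \<noteq> 0 \<and> A *v x = \<mu> *\<^sub>R x)"
  unfolding poly_charpoly det_eq_0_iff_kernel
  by (auto simp: matrix_vector_mult_diff_rdistrib mat_mult_vec)

text \<open>The zero polynomial has an empty multiset of roots, so this is what gives the eigenvalue list its
  meaning. A number exceeding the operator norm of the matrix is not an eigenvalue.\<close>

lemma charpoly_nonzero: "charpoly (A :: real^'n^'n) \<noteq> 0"
proof
  assume "charpoly A = 0"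
  define \<mu> where "\<mu> = onorm ((*v) A) + 1"
  have "\<mu> > 0" using onorm_pos_le[of "(*v) A"] by (simp add: \<mu>_def add_nonneg_pos)
  from \<open>charpoly A = 0\<close> obtain x where "x \<noteq> 0" and x: "A *v x = \<mu> *\<^sub>R x"
    using poly_charpoly_eq_0_iff[of A \<mu>] by auto
  have "\<mu> * norm x = norm (A *v x)" using x \<open>\<mu> > 0\<close> by simp
  also have "\<dots> \<le> onorm ((*v) A) * norm x" by (rule onorm) simp
  finally show False using \<open>x \<noteq> 0\<close> by (simp add: \<mu>_def)
qed

lemma set_eigenvalues: "set (eigenvalues A) = {\<mu>. \<exists>x. x \<noteq> 0 \<and> A *v x = \<mu> *\<^sub>R x}"
  unfolding eigenvalues_def
  by (simp add: charpoly_nonzero poly_charpoly_eq_0_iff)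

lemma sorted_nth_1_le:
  fixes xs :: "'a::linorder list"
  assumes "sorted xs" "a \<in> set xs" "b \<in> set xs" "a < b"
  shows "xs ! 1 \<le> b"
proof -
  obtain i j where ij: "i < length xs" "xs ! i = a" "j < length xs" "xs ! j = b"
    using assms(2,3) by (auto simp: in_set_conv_nth)
  have "1 \<le> j"
  proof (rule ccontr)
    assume "\<not> 1 \<le> j"
    then have "j = 0" by simp
    then have "b \<le> a" using sorted_nth_mono[OF assms(1), of 0 i] ij by simp
    then show False using assms(4) by simp
  qed
  then show ?thesis using sorted_nth_mono[OF assms(1), of 1 j] ij by simp
qed

lemma lambda2_le_eigenvalue:
  assumes "x \<noteq> 0" "A *v x = \<mu> *\<^sub>R x" "y \<noteq> 0" "A *v y = \<nu> *\<^sub>R y" "\<mu> < \<nu>"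
  shows "lambda2 A \<le> \<nu>"
  unfolding lambda2_def
proof (rule sorted_nth_1_le)
  show "sorted (eigenvalues A)" by (simp add: eigenvalues_def)
  show "\<mu> \<in> set (eigenvalues A)" "\<nu> \<in> set (eigenvalues A)"
    using assms unfolding set_eigenvalues by blast+
qed fact

lemma inner_matrix_vector_symmetric:
  fixes A :: "real^'n^'n"
  assumes "transpose A = A"
  shows "x \<bullet> (A *v y) = (A *v x) \<bullet> y"
  using assms by (metis dot_lmul_matrix transpose_matrix_vector)

text \<open>A symmetric matrix maps the orthogonal complement of a kernel vector \<open>c\<close> into itself, so on that
  complement the Rayleigh quotient attains its minimum at an eigenvector. The hypothesis on \<open>u\<close>
  makes the complement nontrivial.\<close>

lemma rayleigh_minimizer_is_eigenvector:
  fixes A :: "real^'n^'n"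
  assumes sym: "transpose A = A" and ker: "A *v c = 0"
    and ne: "u \<noteq> 0" "c \<bullet> u = 0"
  obtains y \<mu> where "y \<noteq> 0" "c \<bullet> y = 0" "A *v y = \<mu> *\<^sub>R y"
    "\<And>x. c \<bullet> x = 0 \<Longrightarrow> \<mu> * (x \<bullet> x) \<le> x \<bullet> (A *v x)"
proof -
  define S where "S = sphere 0 1 \<inter> {x. c \<bullet> x = 0}"
  have "compact S" unfolding S_def by (intro compact_Int_closed closed_hyperplane) simp
  moreover have "u /\<^sub>R norm u \<in> S" using ne by (simp add: S_def)
  moreover have "continuous_on S (\<lambda>x. x \<bullet> (A *v x))"
    by (intro continuous_intros linear_continuous_on) simp
  ultimately obtain y where y: "y \<in> S" and min: "\<And>x. x \<in> S \<Longrightarrow> y \<bullet> (A *v y) \<le> x \<bullet> (A *v x)"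
    using continuous_attains_inf[of S "\<lambda>x. x \<bullet> (A *v x)"] by blast
  define \<mu> where "\<mu> = y \<bullet> (A *v y)"
  have y1: "c \<bullet> y = 0" "y \<bullet> y = 1" "y \<noteq> 0" using y by (auto simp: S_def norm_eq_1)
  have ray: "\<mu> * (x \<bullet> x) \<le> x \<bullet> (A *v x)" if "c \<bullet> x = 0" for x
  proof (cases "x = 0")
    case False
    then have "x /\<^sub>R norm x \<in> S" using that by (simp add: S_def)
    from min[OF this] have "\<mu> \<le> (x \<bullet> (A *v x)) / (norm x)\<^sup>2"
      by (simp add: \<mu>_def matrix_vector_mult_scaleR power2_eq_square divide_simps)
    then show ?thesis using False by (simp add: power2_norm_eq_inner pos_le_divide_eq)
  qed simp
  define r where "r = A *v y - \<mu> *\<^sub>R y"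
  have cr: "c \<bullet> r = 0"
    using inner_matrix_vector_symmetric[OF sym, of c y] ker y1 by (simp add: r_def inner_diff_right)
  define Q where "Q = r \<bullet> (A *v r) - \<mu> * (r \<bullet> r)"
  have "Q \<ge> 0" using ray[OF cr] by (simp add: Q_def)
  define e where "e = - (r \<bullet> r) / (Q + 1)"
  (* First variation of the Rayleigh quotient at its minimizer, along the residual r; the step e is
     chosen so that a nonzero residual would push the quotient below its minimum. *)
  have "0 \<le> (y + e *\<^sub>R r) \<bullet> (A *v (y + e *\<^sub>R r)) - \<mu> * ((y + e *\<^sub>R r) \<bullet> (y + e *\<^sub>R r))"
    using ray[of "y + e *\<^sub>R r"] y1 cr by (simp add: inner_add_right)
  also have "\<dots> = 2 * e * (r \<bullet> (A *v y) - \<mu> * (r \<bullet> y)) + e\<^sup>2 * Q"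
    using y1 inner_matrix_vector_symmetric[OF sym, of y r]
    by (simp add: Q_def \<mu>_def[symmetric] matrix_vector_mult_scaleR matrix_vector_right_distrib
        inner_add_left inner_add_right inner_commute[of y r] inner_commute[of "A *v y" r]
        power2_eq_square algebra_simps)
  also have "r \<bullet> (A *v y) - \<mu> * (r \<bullet> y) = r \<bullet> r"
    by (simp add: r_def inner_diff_right)
  also have "2 * e * (r \<bullet> r) + e\<^sup>2 * Q = - ((r \<bullet> r) / (Q + 1))\<^sup>2 * (Q + 2)"
    using \<open>Q \<ge> 0\<close> by (simp add: e_def power2_eq_square divide_simps) algebra
  finally have "((r \<bullet> r) / (Q + 1))\<^sup>2 * (Q + 2) \<le> 0" by simp
  then have "((r \<bullet> r) / (Q + 1))\<^sup>2 \<le> 0" using \<open>Q \<ge> 0\<close> by (simp add: mult_le_0_iff)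
  then have "r = 0" using \<open>Q \<ge> 0\<close> by (auto simp: power2_less_eq_zero_iff)
  then show ?thesis using that[of y \<mu>] y1 ray by (simp add: r_def)
qed

lemma laplacian_mult_component:
  "(laplacian G *v y) $ i = (\<Sum>j\<in>UNIV. adjacency G $ i $ j * (y $ i - y $ j))"
proof -
  have "(laplacian G *v y) $ i = (\<Sum>j\<in>UNIV. (if i = j then (\<Sum>k\<in>UNIV. adjacency G $ i $ k) * y $ j else 0)
      - adjacency G $ i $ j * y $ j)"
    unfolding laplacian_def diag_def matrix_vector_mult_def
    by (auto intro!: sum.cong simp: left_diff_distrib)
  also have "\<dots> = (\<Sum>k\<in>UNIV. adjacency G $ i $ k) * y $ i - (\<Sum>j\<in>UNIV. adjacency G $ i $ j * y $ j)"
    by (simp add: sum_subtractf)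
  finally show ?thesis by (simp add: sum_distrib_right right_diff_distrib sum_subtractf)
qed

lemma laplacian_mult_ones: "laplacian G *v vec 1 = 0"
  by (simp add: vec_eq_iff laplacian_mult_component)

lemma adjacency_symmetric:
  assumes "graph G"
  shows "adjacency G $ i $ j = adjacency G $ j $ i"
proof -
  interpret graph G by fact
  show ?thesis using arcs_ends_symmetric[OF sym_arcs] by (auto simp: adjacency_def)
qed

lemma transpose_laplacian:
  assumes "graph G"
  shows "transpose (laplacian G) = laplacian G"
  using adjacency_symmetric[OF assms] by (simp add: vec_eq_iff laplacian_def transpose_def diag_def)

lemma laplacian_quadratic_form:
  assumes "graph G"
  shows "y \<bullet> (laplacian G *v y) = (\<Sum>i\<in>UNIV. \<Sum>j\<in>UNIV. adjacency G $ i $ j * (y $ i - y $ j)\<^sup>2) / 2"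
proof -
  let ?a = "\<lambda>i j. adjacency G $ i $ j"
  have 1: "y \<bullet> (laplacian G *v y) = (\<Sum>i\<in>UNIV. \<Sum>j\<in>UNIV. ?a i j * (y $ i * (y $ i - y $ j)))"
    by (simp add: inner_vec_def laplacian_mult_component sum_distrib_left algebra_simps)
  also have "\<dots> = (\<Sum>j\<in>UNIV. \<Sum>i\<in>UNIV. ?a i j * (y $ i * (y $ i - y $ j)))"
    by (rule sum.swap)
  also have "\<dots> = (\<Sum>i\<in>UNIV. \<Sum>j\<in>UNIV. ?a i j * (y $ j * (y $ j - y $ i)))"
    using adjacency_symmetric[OF assms] by simp
  finally have "2 * (y \<bullet> (laplacian G *v y)) = (\<Sum>i\<in>UNIV. \<Sum>j\<in>UNIV.
      ?a i j * (y $ i * (y $ i - y $ j)) + ?a i j * (y $ j * (y $ j - y $ i)))"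
    using 1 by (simp add: sum.distrib)
  also have "\<dots> = (\<Sum>i\<in>UNIV. \<Sum>j\<in>UNIV. ?a i j * (y $ i - y $ j)\<^sup>2)"
    by (simp add: power2_eq_square algebra_simps)
  finally show ?thesis by simp
qed

text \<open>If the quadratic form vanishes at \<open>y\<close>, then \<open>y\<close> agrees at the two ends of each arc, hence is
  constant by connectivity, hence zero because its entries sum to zero.\<close>

lemma laplacian_positive_on_sum_zero:
  fixes G :: "('n::finite, 'l) pre_digraph"
  assumes G: "graph G" "verts G = UNIV" "Digraph_Component.connected G"
    and y: "vec 1 \<bullet> y = 0" "y \<noteq> 0"
  shows "0 < y \<bullet> (laplacian G *v y)"
proof (rule ccontr)
  interpret graph G by fact
  let ?t = "\<lambda>i j. adjacency G $ i $ j * (y $ i - y $ j)\<^sup>2"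
  have nonneg: "?t i j \<ge> 0" for i j by (simp add: adjacency_def)
  assume "\<not> 0 < y \<bullet> (laplacian G *v y)"
  then have "(\<Sum>i\<in>UNIV. \<Sum>j\<in>UNIV. ?t i j) \<le> 0"
    by (simp add: laplacian_quadratic_form[OF G(1)])
  then have "(\<Sum>i\<in>UNIV. \<Sum>j\<in>UNIV. ?t i j) = 0"
    using nonneg by (meson antisym sum_nonneg)
  then have t0: "?t i j = 0" for i j
    using nonneg by (simp add: sum_nonneg_eq_0_iff sum_nonneg)
  have arc: "y $ i = y $ j" if "(i, j) \<in> arcs_ends G" for i j
    using t0[of i j] that by (simp add: adjacency_def)
  have const: "y $ i = y $ j" for i j
  proof -
    have "reachable G i j"
      using symmetric_connected_imp_strongly_connected[OF sym_arcs G(3)] G(2)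
      by (auto simp: strongly_connected_def)
    then have "(i, j) \<in> (arcs_ends G)\<^sup>*" by (rule reachable_rtranclI)
    then show ?thesis by induction (auto dest: arc)
  qed
  have "y $ i = 0" for i
  proof -
    have "(\<Sum>j\<in>UNIV. y $ j) = (\<Sum>j\<in>(UNIV::'n set). y $ i)" by (intro sum.cong refl const)
    then show ?thesis using y(1) by (simp add: inner_vec_def)
  qed
  then show False using y(2) by (simp add: vec_eq_iff)
qed

text \<open>The minimum \<open>\<mu>\<close> of the Rayleigh quotient on vectors of sum zero is an eigenvalue, and it is positive.
  Together with the eigenvalue 0 of the all-ones vector it shows that the second smallest eigenvalue
  is at most \<open>\<mu>\<close>: of two distinct entries of a sorted list, the larger is not the first.\<close>

lemma lambda2_laplacian_le_rayleigh:
  fixes G :: "('n::finite, 'l) pre_digraph"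
  assumes "CARD('n) \<ge> 2" and G: "graph G" "verts G = UNIV" "Digraph_Component.connected G"
    and x: "vec 1 \<bullet> x = 0"
  shows "lambda2 (laplacian G) * (x \<bullet> x) \<le> x \<bullet> (laplacian G *v x)"
proof -
  obtain i j :: 'n where "i \<noteq> j"
    using \<open>CARD('n) \<ge> 2\<close> by (metis card_2_iff' ex_card UNIV_I)
  let ?u = "axis i 1 - axis j 1 :: real^'n"
  have "?u \<noteq> 0" using \<open>i \<noteq> j\<close> by (simp add: axis_eq_axis)
  moreover have "vec 1 \<bullet> ?u = 0" by (simp add: inner_diff_right inner_axis)
  ultimately obtain y \<mu> where y: "y \<noteq> 0" "vec 1 \<bullet> y = 0" "laplacian G *v y = \<mu> *\<^sub>R y"
    and ray: "\<And>x. vec 1 \<bullet> x = 0 \<Longrightarrow> \<mu> * (x \<bullet> x) \<le> x \<bullet> (laplacian G *v x)"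
    using rayleigh_minimizer_is_eigenvector[OF transpose_laplacian[OF G(1)] laplacian_mult_ones] by metis
  have "0 < \<mu> * (y \<bullet> y)"
    using laplacian_positive_on_sum_zero[OF G y(2,1)] y(3) by simp
  moreover have "0 < y \<bullet> y" using y(1) by simp
  ultimately have "0 < \<mu>" by (rule zero_less_mult_pos2)
  moreover have "laplacian G *v vec 1 = 0 *\<^sub>R vec 1" using laplacian_mult_ones[of G] by simp
  moreover have "(vec 1 :: real^'n) \<noteq> 0" by (simp add: vec_eq_iff)
  ultimately have "lambda2 (laplacian G) \<le> \<mu>" using lambda2_le_eigenvalue y(1,3) by metis
  then have "lambda2 (laplacian G) * (x \<bullet> x) \<le> \<mu> * (x \<bullet> x)" by (intro mult_right_mono) auto
  then show ?thesis using ray[OF x] by simp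
qed

lemma sum_arcs_eq_sum_adjacency:
  fixes G :: "('n::finite, 'l::finite) pre_digraph"
  assumes "graph G" "arcs G = UNIV"
  shows "(\<Sum>e\<in>UNIV. f (tail G e) (head G e)) = (\<Sum>i\<in>UNIV. \<Sum>j\<in>UNIV. adjacency G $ i $ j * f i j)"
proof -
  interpret graph G by fact
  have "(\<Sum>e\<in>UNIV. f (tail G e) (head G e)) = (\<Sum>e\<in>arcs G. case_prod f (arc_to_ends G e))"
    by (simp add: assms(2) arc_to_ends_def)
  also have "\<dots> = (\<Sum>q\<in>arcs_ends G. case_prod f q)"
    unfolding arcs_ends_def by (simp add: sum.reindex[OF inj_on_arc_to_ends])
  also have "\<dots> = (\<Sum>q\<in>UNIV. if q \<in> arcs_ends G then case_prod f q else 0)"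
    by (simp add: sum.If_cases)
  also have "\<dots> = (\<Sum>(i, j)\<in>UNIV \<times> UNIV. adjacency G $ i $ j * f i j)"
    by (intro sum.cong) (auto simp: adjacency_def)
  finally show ?thesis by (simp add: sum.cartesian_product)
qed

text \<open>The Rayleigh bound and Cauchy--Schwarz give \<open>\<lambda>\<^sub>2 \<parallel>y\<parallel>\<^sub>2 \<le> \<parallel>L y\<parallel>\<^sub>2 \<le> \<parallel>L y\<parallel>\<^sub>1\<close>. Every undirected
  edge contributes to the 1-norm of \<open>L y\<close> at both of its ends, which matches the two arcs that
  represent it on the right-hand side.\<close>

lemma lambda2_norm_le_variation:
  fixes G :: "('n::finite, 'l::finite) pre_digraph"
  assumes n: "CARD('n) \<ge> 2" and G: "graph G" "verts G = UNIV" "arcs G = UNIV" "Digraph_Component.connected G"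
    and y: "vec 1 \<bullet> y = 0"
  shows "lambda2 (laplacian G) * norm y \<le> (\<Sum>e\<in>UNIV. \<bar>y $ head G e - y $ tail G e\<bar>)"
proof -
  have "lambda2 (laplacian G) * norm y * norm y \<le> y \<bullet> (laplacian G *v y)"
    using lambda2_laplacian_le_rayleigh[OF n G(1,2,4) y]
    by (simp add: power2_norm_eq_inner[symmetric] power2_eq_square mult.assoc)
  also have "\<dots> \<le> norm (laplacian G *v y) * norm y"
    using norm_cauchy_schwarz[of y "laplacian G *v y"] by (simp add: mult.commute)
  finally have "lambda2 (laplacian G) * norm y \<le> norm (laplacian G *v y)"
    by (cases "y = 0") auto
  also have "\<dots> \<le> (\<Sum>i\<in>UNIV. \<bar>(laplacian G *v y) $ i\<bar>)" by (rule norm_le_l1_cart)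
  also have "\<dots> \<le> (\<Sum>i\<in>UNIV. \<Sum>j\<in>UNIV. adjacency G $ i $ j * \<bar>y $ j - y $ i\<bar>)"
  proof (rule sum_mono)
    fix i
    have "\<bar>(laplacian G *v y) $ i\<bar> \<le> (\<Sum>j\<in>UNIV. \<bar>adjacency G $ i $ j * (y $ i - y $ j)\<bar>)"
      unfolding laplacian_mult_component by (rule sum_abs)
    also have "\<dots> = (\<Sum>j\<in>UNIV. adjacency G $ i $ j * \<bar>y $ j - y $ i\<bar>)"
      by (intro sum.cong refl) (simp add: abs_mult adjacency_def abs_minus_commute)
    finally show "\<bar>(laplacian G *v y) $ i\<bar> \<le> (\<Sum>j\<in>UNIV. adjacency G $ i $ j * \<bar>y $ j - y $ i\<bar>)" .
  qed
  also have "\<dots> = (\<Sum>e\<in>UNIV. \<bar>y $ head G e - y $ tail G e\<bar>)"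
    by (rule sum_arcs_eq_sum_adjacency[OF G(1,3), of "\<lambda>i j. \<bar>y $ j - y $ i\<bar>", symmetric])
  finally show ?thesis .
qed

section \<open>Differences along arcs\<close>

definition edge_difference ::
  "('n::finite, 'l::finite) pre_digraph \<Rightarrow> real^('n \<times> 'c)^('l \<times> 'c::finite)" where
  "edge_difference G = kron (transpose (incidence G)) (mat 1)"

lemma transpose_kron: "transpose (kron A B) = kron (transpose A) (transpose B)"
  unfolding kron_def transpose_def by (simp only: vec_lambda_beta)

lemma edge_difference_nth:
  fixes G :: "('n::finite, 'l::finite) pre_digraph" and X :: "real^('n \<times> 'c::finite)"
  assumes "graph G" "arcs G = UNIV"
  shows "(edge_difference G *v X) $ (e, k) = X $ (head G e, k) - X $ (tail G e, k)"
proof -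
  interpret graph G by fact
  have B: "incidence G $ i $ e = (if head G e = i then 1 else 0) - (if tail G e = i then 1 else 0)" for i
    using no_loops[of e] by (auto simp: incidence_def assms(2))
  have "(edge_difference G *v X) $ (e, k)
      = (\<Sum>(i, m)\<in>UNIV \<times> UNIV. incidence G $ i $ e * (if k = m then 1 else 0) * X $ (i, m))"
    unfolding edge_difference_def matrix_vector_mult_def
    by (simp add: kron_def transpose_def mat_def case_prod_unfold)
  also have "\<dots> = (\<Sum>i\<in>UNIV. \<Sum>m\<in>UNIV. if k = m then incidence G $ i $ e * X $ (i, m) else 0)"
    unfolding sum.cartesian_product[symmetric] by (intro sum.cong refl) auto
  also have "\<dots> = (\<Sum>i\<in>UNIV. incidence G $ i $ e * X $ (i, k))" by simp
  also have "\<dots> = (\<Sum>i\<in>UNIV. (if head G e = i then X $ (i, k) else 0) - (if tail G e = i then X $ (i, k) else 0))"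
    unfolding B by (intro sum.cong refl) auto
  also have "\<dots> = X $ (head G e, k) - X $ (tail G e, k)"
    by (simp add: sum_subtractf)
  finally show ?thesis .
qed

lemma edge_difference_consensus:
  assumes "graph G" "arcs G = UNIV"
  shows "edge_difference G *v kron_vec (vec 1) m = 0"
proof (rule vec_eq_iff[THEN iffD2], rule allI)
  fix r
  show "(edge_difference G *v kron_vec (vec 1) m) $ r = 0 $ r"
    by (cases r) (simp add: edge_difference_nth[OF assms] kron_vec_def)
qed

lemma sum_abs_le_sqrt_card_norm:
  fixes y :: "real^'n"
  shows "(\<Sum>i\<in>UNIV. \<bar>y $ i\<bar>) \<le> sqrt (real CARD('n)) * norm y"
proof -
  have "L2_set (\<lambda>i. y $ i) UNIV = norm y" by (simp add: norm_vec_def L2_set_def)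
  moreover have "L2_set (\<lambda>i. 1) (UNIV :: 'n set) = sqrt (real CARD('n))" by (simp add: L2_set_def)
  ultimately show ?thesis using L2_set_mult_ineq[of "\<lambda>i. y $ i" "\<lambda>i. 1" UNIV] by (simp add: mult.commute)
qed

lemma norm_le_sum_norm_slices:
  fixes X :: "real^('n::finite \<times> 'c::finite)"
  shows "norm X \<le> (\<Sum>k\<in>UNIV. norm (\<chi> i. X $ (i, k)))"
proof -
  have "(\<Sum>r\<in>UNIV. (X $ r)\<^sup>2) = (\<Sum>(i, k)\<in>UNIV \<times> UNIV. (X $ (i, k))\<^sup>2)"
    by (simp add: case_prod_unfold)
  also have "\<dots> = (\<Sum>k\<in>UNIV. \<Sum>i\<in>UNIV. (X $ (i, k))\<^sup>2)"
    unfolding sum.cartesian_product[symmetric] by (rule sum.swap)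
  finally have "norm X = L2_set (\<lambda>k. norm (\<chi> i. X $ (i, k))) UNIV"
    by (simp add: norm_vec_def L2_set_def sum_nonneg)
  then show ?thesis by (simp add: L2_set_le_sum)
qed

text \<open>The two ways in which the total variation \<open>b\<close> along the arcs dominates a vector of sum zero: the
  first gives the rate of decay, the second absorbs a disturbance bounded in the supremum norm. Both
  follow by adding the scalar estimate over the slices of \<open>X\<close> that collect one component of all the
  blocks.\<close>

lemma edge_variation_bounds:
  fixes G :: "('n::finite, 'l::finite) pre_digraph" and X :: "real^('n \<times> 'c::finite)"
  assumes n: "CARD('n) \<ge> 2" and G: "graph G" "verts G = UNIV" "arcs G = UNIV" "Digraph_Component.connected G"
    and pos: "lambda2 (laplacian G) > 0"
    and X: "\<And>k. (\<Sum>i\<in>UNIV. X $ (i, k)) = 0"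
  defines "b \<equiv> \<Sum>r\<in>UNIV. \<bar>(edge_difference G *v X) $ r\<bar>"
  shows "lambda2 (laplacian G) * norm X \<le> b"
    and "lambda2 (laplacian G) * (\<Sum>r\<in>UNIV. \<bar>X $ r\<bar>) \<le> sqrt (real CARD('n)) * b"
proof -
  let ?y = "\<lambda>k. \<chi> i. X $ (i, k)" and ?L = "lambda2 (laplacian G)"
  let ?v = "\<lambda>k. \<Sum>e\<in>UNIV. \<bar>X $ (head G e, k) - X $ (tail G e, k)\<bar>"
  have v: "?L * norm (?y k) \<le> ?v k" for k
    using lambda2_norm_le_variation[OF n G, of "?y k"] X[of k] by (simp add: inner_vec_def)
  have b: "b = (\<Sum>k\<in>UNIV. ?v k)"
  proof -
    have "b = (\<Sum>(e, k)\<in>UNIV \<times> UNIV. \<bar>X $ (head G e, k) - X $ (tail G e, k)\<bar>)"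
      unfolding b_def by (intro sum.cong) (auto simp: edge_difference_nth[OF G(1,3)])
    also have "\<dots> = (\<Sum>k\<in>UNIV. ?v k)"
      unfolding sum.cartesian_product[symmetric] by (rule sum.swap)
    finally show ?thesis .
  qed
  have "?L * norm X \<le> ?L * (\<Sum>k\<in>UNIV. norm (?y k))"
    using norm_le_sum_norm_slices[of X] pos by (intro mult_left_mono) auto
  also have "\<dots> \<le> b" unfolding b sum_distrib_left by (intro sum_mono v)
  finally show "?L * norm X \<le> b" .
  have "(\<Sum>r\<in>UNIV. \<bar>X $ r\<bar>) = (\<Sum>(i, k)\<in>UNIV \<times> UNIV. \<bar>X $ (i, k)\<bar>)"
    by (simp add: case_prod_unfold)
  also have "\<dots> = (\<Sum>k\<in>UNIV. \<Sum>i\<in>UNIV. \<bar>?y k $ i\<bar>)"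
    unfolding sum.cartesian_product[symmetric] vec_lambda_beta by (rule sum.swap)
  also have "\<dots> \<le> (\<Sum>k\<in>UNIV. sqrt (real CARD('n)) * norm (?y k))"
    by (intro sum_mono sum_abs_le_sqrt_card_norm)
  finally have "?L * (\<Sum>r\<in>UNIV. \<bar>X $ r\<bar>) \<le> ?L * (\<Sum>k\<in>UNIV. sqrt (real CARD('n)) * norm (?y k))"
    using pos by (intro mult_left_mono) auto
  also have "\<dots> = sqrt (real CARD('n)) * (\<Sum>k\<in>UNIV. ?L * norm (?y k))"
    by (simp add: sum_distrib_left mult_ac)
  also have "\<dots> \<le> sqrt (real CARD('n)) * b"
    unfolding b by (intro mult_left_mono sum_mono v) auto
  finally show "?L * (\<Sum>r\<in>UNIV. \<bar>X $ r\<bar>) \<le> sqrt (real CARD('n)) * b" .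
qed

section \<open>Dissipation of the consensus error\<close>

lemma inner_consensus_rhs:
  "a \<bullet> consensus_rhs G \<beta> \<Phi> t w
    = - \<beta> * ((edge_difference G *v a) \<bullet> sgn_vec (edge_difference G *v (w + \<Phi> t)))"
proof -
  have "kron (incidence G) (mat 1) = transpose (edge_difference G :: real^('a \<times> 6)^('b \<times> 6))"
    by (simp add: edge_difference_def transpose_kron)
  then show ?thesis
    unfolding consensus_rhs_def edge_difference_def[symmetric]
    by (metis (no_types) dot_lmul_matrix inner_commute inner_scaleR_right transpose_matrix_vector)
qed

text \<open>An entry of \<open>M (x + c)\<close> that is nonzero keeps its sign near \<open>x\<close>, and an entry that is zero
  contributes nothing whatever the sign of its perturbation.\<close>

lemma sign_pattern_locally_constant:
  fixes M :: "real^'n^'m"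
  obtains \<delta> where "\<delta> > 0"
    "\<And>y. y \<in> ball x \<delta> \<Longrightarrow> (M *v (x + c)) \<bullet> sgn_vec (M *v (y + c)) = (\<Sum>r\<in>UNIV. \<bar>(M *v (x + c)) $ r\<bar>)"
proof -
  let ?q = "\<lambda>y. M *v (y + c)"
  have lim: "((\<lambda>y. ?q y $ r) \<longlongrightarrow> ?q x $ r) (nhds x)" for r
    by (intro tendsto_vec_nth bounded_linear.tendsto[OF matrix_vector_mul_bounded_linear] tendsto_intros
        filterlim_ident)
  have "\<forall>\<^sub>F y in nhds x. ?q x $ r * sgn (?q y $ r) = \<bar>?q x $ r\<bar>" for r
  proof (cases "?q x $ r" "0::real" rule: linorder_cases)
    case less
    show ?thesis using order_tendstoD(2)[OF lim less] by eventually_elim (use less in simp)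
  next
    case greater
    show ?thesis using order_tendstoD(1)[OF lim greater] by eventually_elim (use greater in simp)
  qed simp
  then have "\<forall>\<^sub>F y in nhds x. \<forall>r. ?q x $ r * sgn (?q y $ r) = \<bar>?q x $ r\<bar>"
    by (rule eventually_all_finite)
  then obtain \<delta> where "\<delta> > 0" "\<And>y. dist y x < \<delta> \<Longrightarrow> \<forall>r. ?q x $ r * sgn (?q y $ r) = \<bar>?q x $ r\<bar>"
    unfolding eventually_nhds_metric by blast
  then show ?thesis
    by (intro that[of \<delta>]) (auto simp: inner_vec_def Defs.sgn_vec_def dist_commute)
qed

lemma filippov_consensus_conserves:
  assumes "u \<in> filippov_map (consensus_rhs G \<beta> \<Phi>) t w" "edge_difference G *v a = 0"
  shows "a \<bullet> u = 0"
proof (rule filippov_map_inner_eq[OF zero_less_one _ assms(1)])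
  show "a \<bullet> consensus_rhs G \<beta> \<Phi> t y = 0" for y
    unfolding inner_consensus_rhs assms(2) by simp
qed

lemma filippov_consensus_dissipation:
  assumes "u \<in> filippov_map (consensus_rhs G \<beta> \<Phi>) t w"
  shows "(w + \<Phi> t) \<bullet> u = - \<beta> * (\<Sum>r\<in>UNIV. \<bar>(edge_difference G *v (w + \<Phi> t)) $ r\<bar>)"
proof -
  obtain \<delta> where "\<delta> > 0" "\<And>y. y \<in> ball w \<delta> \<Longrightarrow>
      (edge_difference G *v (w + \<Phi> t)) \<bullet> sgn_vec (edge_difference G *v (y + \<Phi> t))
        = (\<Sum>r\<in>UNIV. \<bar>(edge_difference G *v (w + \<Phi> t)) $ r\<bar>)"
    using sign_pattern_locally_constant[of w "edge_difference G" "\<Phi> t"] by metis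
  note \<delta> = this
  show ?thesis
  proof (rule filippov_map_inner_eq[OF \<delta>(1) _ assms])
    fix y assume "y \<in> ball w \<delta>"
    then show "(w + \<Phi> t) \<bullet> consensus_rhs G \<beta> \<Phi> t y
        = - \<beta> * (\<Sum>r\<in>UNIV. \<bar>(edge_difference G *v (w + \<Phi> t)) $ r\<bar>)"
      unfolding inner_consensus_rhs by (simp only: \<delta>(2))
  qed
qed

lemma inner_kron_vec_ones:
  fixes X :: "real^('n::finite \<times> 'c::finite)"
  shows "X \<bullet> kron_vec (vec 1) c = (\<Sum>k\<in>UNIV. c $ k * (\<Sum>i\<in>UNIV. X $ (i, k)))"
proof -
  have "X \<bullet> kron_vec (vec 1) c = (\<Sum>(i, k)\<in>UNIV \<times> UNIV. c $ k * X $ (i, k))"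
    by (simp add: inner_vec_def kron_vec_def case_prod_unfold mult.commute)
  also have "\<dots> = (\<Sum>k\<in>UNIV. \<Sum>i\<in>UNIV. c $ k * X $ (i, k))"
    unfolding sum.cartesian_product[symmetric] by (rule sum.swap)
  finally show ?thesis by (simp add: sum_distrib_left)
qed

text \<open>The reference \<open>m\<close>, subtracted from every block, drops out because the arc differences annihilate
  it, and its velocity \<open>c\<close> because \<open>X\<close> is orthogonal to it.
  Of the gain \<open>\<beta>\<close>, the part \<open>\<gamma> \<surd>n / \<lambda>\<^sub>2\<close> compensates the signals \<open>\<phi>'\<close> and the remaining part, at
  least 1, gives the decay.\<close>

lemma consensus_error_dissipation:
  fixes G :: "('n::finite, 'l::finite) pre_digraph" and X :: "real^('n \<times> 6)" and \<phi>' :: "'n \<Rightarrow> real^6"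
  assumes n: "CARD('n) \<ge> 2" and G: "graph G" "verts G = UNIV" "arcs G = UNIV" "Digraph_Component.connected G"
    and pos: "lambda2 (laplacian G) > 0"
    and u: "u \<in> filippov_map (consensus_rhs G \<beta> \<Phi>) t w"
    and X: "X = w + \<Phi> t - kron_vec (vec 1) m" and X0: "\<And>k. (\<Sum>i\<in>UNIV. X $ (i, k)) = 0"
    and \<phi>': "\<And>i k. \<bar>\<phi>' i $ k\<bar> \<le> \<gamma>"
    and gain: "\<beta> \<ge> 1 + \<gamma> * (sqrt (real CARD('n)) / lambda2 (laplacian G))"
  shows "X \<bullet> (u + (stack \<phi>' - kron_vec (vec 1) c)) \<le> - lambda2 (laplacian G) * norm X"
proof -
  let ?L = "lambda2 (laplacian G)" and ?s = "sqrt (real CARD('n))"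
  define b where "b = (\<Sum>r\<in>UNIV. \<bar>(edge_difference G *v X) $ r\<bar>)"
  have "b \<ge> 0" unfolding b_def by (simp add: sum_nonneg)
  have "\<gamma> \<ge> 0" using \<phi>' abs_ge_zero order_trans by blast
  note bounds = edge_variation_bounds[OF n G pos X0, folded b_def]
  have agree: "edge_difference G *v kron_vec (vec 1) m = 0"
    by (rule edge_difference_consensus[OF G(1,3)])
  have "edge_difference G *v X = edge_difference G *v (w + \<Phi> t)"
    unfolding X matrix_vector_mult_diff_distrib agree by simp
  then have "X \<bullet> u = - \<beta> * b"
    using filippov_consensus_dissipation[OF u] filippov_consensus_conserves[OF u agree]
    unfolding b_def X by (simp add: inner_diff_left)
  moreover have "X \<bullet> kron_vec (vec 1) c = 0" unfolding inner_kron_vec_ones X0 by simp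
  moreover have "X \<bullet> stack \<phi>' \<le> \<gamma> * (?s / ?L) * b"
  proof -
    have "X \<bullet> stack \<phi>' \<le> (\<Sum>r\<in>UNIV. \<gamma> * \<bar>X $ r\<bar>)"
      unfolding inner_vec_def
    proof (rule sum_mono)
      fix r
      have "X $ r \<bullet> stack \<phi>' $ r \<le> \<bar>X $ r\<bar> * \<bar>stack \<phi>' $ r\<bar>"
        by (simp add: abs_mult[symmetric])
      also have "\<dots> \<le> \<bar>X $ r\<bar> * \<gamma>" using \<phi>' by (intro mult_left_mono) (auto simp: stack_def)
      finally show "X $ r \<bullet> stack \<phi>' $ r \<le> \<gamma> * \<bar>X $ r\<bar>" by (simp add: mult.commute)
    qed
    also have "\<dots> = \<gamma> * (\<Sum>r\<in>UNIV. \<bar>X $ r\<bar>)" by (simp add: sum_distrib_left)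
    also have "\<dots> \<le> \<gamma> * (?s * b / ?L)"
      using bounds(2) pos \<open>\<gamma> \<ge> 0\<close> by (intro mult_left_mono) (auto simp: pos_le_divide_eq mult.commute)
    finally show ?thesis by simp
  qed
  ultimately have "X \<bullet> (u + (stack \<phi>' - kron_vec (vec 1) c)) \<le> - (\<beta> - \<gamma> * (?s / ?L)) * b"
    by (simp add: inner_add_right inner_diff_right left_diff_distrib)
  also have "\<dots> \<le> - 1 * b"
    using gain \<open>b \<ge> 0\<close> by (intro mult_right_mono) auto
  finally show ?thesis using bounds(1) by simp
qed

section \<open>Regularity of the signals\<close>

lemma has_vector_derivative_vec:
  fixes f :: "real \<Rightarrow> real^'n"
  assumes "\<And>r. ((\<lambda>t. f t $ r) has_vector_derivative f' $ r) (at t within S)"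
  shows "(f has_vector_derivative f') (at t within S)"
  using assms unfolding has_vector_derivative_def has_derivative_componentwise_within[of f]
  by (auto simp: Basis_vec_def inner_axis)

lemma has_vector_derivative_vec_nth:
  assumes "(f has_vector_derivative f') F"
  shows "((\<lambda>t. f t $ r) has_vector_derivative f' $ r) F"
  using bounded_linear.has_vector_derivative[OF bounded_linear_vec_nth assms] .

lemma differentiable_vector_nth:
  fixes fs :: "('a::real_normed_vector \<Rightarrow> real) list"
  assumes "\<forall>f\<in>set fs. f differentiable F"
  shows "(\<lambda>t. vector (map (\<lambda>f. f t) fs) $ k) differentiable F"
proof -
  have "(\<lambda>t. foldr (\<lambda>x f n. fun_upd (f (n + 1)) n x) (map (\<lambda>f. f t) fs) (\<lambda>n x. 0) n k) differentiable F" for n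
    using assms
  proof (induction fs arbitrary: n)
    case (Cons f fs)
    then show ?case by (cases "k = n") auto
  qed simp
  then show ?thesis by (simp add: vector_def)
qed

lemma regressor_differentiable:
  fixes z :: "'a::real_normed_vector \<Rightarrow> real"
  assumes z: "z differentiable (at t within S)" and h: "h differentiable (at t within S)"
  shows "(\<lambda>t. regressor (z t) (h t)) differentiable (at t within S)"
proof -
  let ?fs = "[\<lambda>t. h t $ 1 * h t $ 1, \<lambda>t. h t $ 2 * h t $ 1, \<lambda>t. h t $ 1 * h t $ 2, \<lambda>t. h t $ 2 * h t $ 2,
    \<lambda>t. z t * h t $ 1, \<lambda>t. z t * h t $ 2]"
  have hd: "(\<lambda>t. h t $ i) differentiable (at t within S)" for i
    using h bounded_linear.has_derivative[OF bounded_linear_vec_nth] unfolding differentiable_def by blast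
  have eq: "regressor (z t) (h t) = vector (map (\<lambda>f. f t) ?fs)" for t
    by (simp add: regressor_def Let_def matrix_matrix_mult_def columnvector_def rowvector_def)
  have "(\<lambda>t. regressor (z t) (h t) $ k) differentiable (at t within S)" for k
    unfolding eq by (rule differentiable_vector_nth[of ?fs]) (auto intro!: differentiable_mult z hd)
  then have "(\<lambda>t. regressor (z t) (h t) \<bullet> b) differentiable (at t within S)" if "b \<in> Basis" for b
    using that by (auto simp: Basis_vec_def inner_axis)
  then show ?thesis
    unfolding differentiable_componentwise_within[of "\<lambda>t. regressor (z t) (h t)"] by blast
qed

lemma bounded_C1_on_differentiable:
  assumes "bounded_C1_on f S" "t \<in> S"
  shows "f differentiable (at t within S)"
  using assms unfolding bounded_C1_on_def by (blast intro: differentiableI_vector)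

lemma norm_increment_le:
  fixes f :: "real \<Rightarrow> 'a::real_normed_vector"
  assumes "convex S" and f: "\<And>t. t \<in> S \<Longrightarrow> (f has_vector_derivative f' t) (at t within S)"
    and B: "\<And>t. t \<in> S \<Longrightarrow> norm (f' t) \<le> B" and "u \<in> S" "v \<in> S" "u \<le> v"
  shows "norm (f v - f u) \<le> B * (v - u)"
proof -
  have "norm (f v - f u) \<le> B * norm (v - u)"
  proof (rule differentiable_bound[OF \<open>convex S\<close> _ _ \<open>v \<in> S\<close> \<open>u \<in> S\<close>])
    fix t assume "t \<in> S"
    show "(f has_derivative (\<lambda>h. h *\<^sub>R f' t)) (at t within S)"
      using f[OF \<open>t \<in> S\<close>] by (simp add: has_vector_derivative_def)
    show "onorm (\<lambda>h. h *\<^sub>R f' t) \<le> B"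
      using mult_left_mono[OF B[OF \<open>t \<in> S\<close>] abs_ge_zero]
      by (intro onorm_le) (simp add: mult.commute)
  qed
  then show ?thesis using \<open>u \<le> v\<close> by simp
qed

section \<open>Finite-time average consensus\<close>

theorem theorem1:
  fixes G :: "('n::finite, 'l::finite) pre_digraph"
    and s :: "'n \<Rightarrow> real^2"
    and p v :: "real \<Rightarrow> real^2"
    and \<theta> z :: "'n \<Rightarrow> real \<Rightarrow> real"
    and h :: "'n \<Rightarrow> real \<Rightarrow> real^2"
    and \<phi> :: "'n \<Rightarrow> real \<Rightarrow> real^6"
    and \<phi>bar :: "real \<Rightarrow> real^6"
    and \<Phi> w x x_err :: "real \<Rightarrow> real^('n \<times> 6)"
    and t0 \<beta> \<gamma> n_hat lam2_hat :: real
  assumes order: "CARD('n) \<ge> 2"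
    and graph: "graph G" "verts G = UNIV" "arcs G = UNIV"
    and conn: "Digraph_Component.connected G"
    and target: "\<And>t. t \<ge> t0 \<Longrightarrow> (p has_vector_derivative v t) (at t within {t0..})"
    and apart: "\<And>i t. t \<ge> t0 \<Longrightarrow> p t \<noteq> s i"
    and angle: "\<And>i t. t \<ge> t0 \<Longrightarrow> \<theta> i t \<in> {0..<2 * pi}"
    and bearing: "\<And>i t. t \<ge> t0 \<Longrightarrow>
      vector [cos (\<theta> i t), sin (\<theta> i t)] = (1 / norm (p t - s i)) *\<^sub>R (p t - s i)"
    and h: "\<And>i t. t \<ge> t0 \<Longrightarrow> h i t = vector [- sin (\<theta> i t), cos (\<theta> i t)]"
    and z: "\<And>i t. t \<ge> t0 \<Longrightarrow> z i t = h i t \<bullet> s i"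
    and z_C1: "\<And>i. bounded_C1_on (z i) {t0..}"
    and h_C1: "\<And>i. bounded_C1_on (h i) {t0..}"
    and \<phi>: "\<And>i t. t \<ge> t0 \<Longrightarrow> \<phi> i t = regressor (z i t) (h i t)"
    and \<gamma>_pos: "\<gamma> > 0"
    and \<gamma>: "\<And>i. (SUP t\<in>{t0..}. ereal (infnorm (vector_derivative (\<phi> i) (at t within {t0..})))) \<le> ereal \<gamma>"
    and \<Phi>: "\<And>t. t \<ge> t0 \<Longrightarrow> \<Phi> t = stack (\<lambda>i. \<phi> i t)"
    and \<phi>bar: "\<And>t. t \<ge> t0 \<Longrightarrow> \<phi>bar t = (1 / real CARD('n)) *\<^sub>R (\<Sum>i\<in>UNIV. \<phi> i t)"
    and w: "filippov_solution (consensus_rhs G \<beta> \<Phi>) t0 w"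
    and x: "\<And>t. t \<ge> t0 \<Longrightarrow> x t = w t + \<Phi> t"
    and x_err: "\<And>t. t \<ge> t0 \<Longrightarrow> x_err t = x t - kron_vec (vec 1) (\<phi>bar t)"
    and init: "w t0 = 0"
    and n_hat: "n_hat > 0" "n_hat \<ge> real CARD('n)"
    and lam2_hat: "lam2_hat > 0" "lam2_hat \<le> lambda2 (laplacian G)"
    and gain: "\<beta> \<ge> 1 + \<gamma> * (sqrt n_hat / lam2_hat)"
  shows "\<forall>t \<ge> t0 + norm (x_err t0) / lambda2 (laplacian G). x_err t = 0"
proof -
  let ?L = "lambda2 (laplacian G)" and ?N = "real CARD('n)"
  have "?N > 0" by simp
  have pos: "?L > 0" using lam2_hat by linarith
  have gain': "\<beta> \<ge> 1 + \<gamma> * (sqrt ?N / ?L)"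
  proof -
    have "sqrt ?N / ?L \<le> sqrt n_hat / lam2_hat"
      using n_hat lam2_hat by (intro frac_le) auto
    then have "\<gamma> * (sqrt ?N / ?L) \<le> \<gamma> * (sqrt n_hat / lam2_hat)"
      using \<gamma>_pos by (intro mult_left_mono) auto
    with gain show ?thesis by linarith
  qed
  define \<phi>' where "\<phi>' i t = vector_derivative (\<phi> i) (at t within {t0..})" for i t
  have \<phi>_deriv: "(\<phi> i has_vector_derivative \<phi>' i t) (at t within {t0..})" if "t \<ge> t0" for i t
  proof -
    have "(\<lambda>t. regressor (z i t) (h i t)) differentiable (at t within {t0..})"
      using that by (intro regressor_differentiable bounded_C1_on_differentiable z_C1 h_C1) auto
    then obtain D where "((\<lambda>t. regressor (z i t) (h i t)) has_derivative D) (at t within {t0..})"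
      unfolding differentiable_def by blast
    then have "(\<phi> i has_derivative D) (at t within {t0..})"
      by (rule has_derivative_transform[rotated 2]) (use that \<phi> in auto)
    then have "\<phi> i differentiable (at t within {t0..})"
      unfolding differentiable_def by blast
    then show ?thesis unfolding \<phi>'_def by (simp add: vector_derivative_works)
  qed
  have \<phi>'_bound: "\<bar>\<phi>' i t $ k\<bar> \<le> \<gamma>" if "t \<ge> t0" for i t k
  proof -
    have "ereal (infnorm (\<phi>' i t)) \<le> ereal \<gamma>"
      unfolding \<phi>'_def using \<gamma>[of i] that by (simp add: SUP_le_iff)
    then show ?thesis using component_le_infnorm_cart[of "\<phi>' i t" k] by simp
  qed
  define mean where "mean y = (1 / ?N) *\<^sub>R (\<Sum>i\<in>UNIV. y i)" for y :: "'n \<Rightarrow> real^6"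
  (* The error is the Filippov solution w plus a Lipschitz perturbation built from the signals. *)
  define \<Psi> where "\<Psi> t = stack (\<lambda>i. \<phi> i t) - kron_vec (vec 1) (mean (\<lambda>i. \<phi> i t))" for t
  define \<Psi>' where "\<Psi>' t = stack (\<lambda>i. \<phi>' i t) - kron_vec (vec 1) (mean (\<lambda>i. \<phi>' i t))" for t
  have \<Psi>_deriv: "(\<Psi> has_vector_derivative \<Psi>' t) (at t within {t0..})" if "t \<ge> t0" for t
  proof (rule has_vector_derivative_vec)
    fix r :: "'n \<times> 6"
    show "((\<lambda>t. \<Psi> t $ r) has_vector_derivative \<Psi>' t $ r) (at t within {t0..})"
      unfolding \<Psi>_def \<Psi>'_def mean_def stack_def kron_vec_def
      by (auto intro!: derivative_intros has_vector_derivative_vec_nth \<phi>_deriv that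
          bounded_linear.has_vector_derivative[OF bounded_linear_divide])
  qed
  have \<Psi>'_bound: "norm (\<Psi>' t) \<le> (\<Sum>r\<in>(UNIV :: ('n \<times> 6) set). 2 * \<gamma>)" if "t \<ge> t0" for t
  proof (rule order_trans[OF norm_le_l1_cart sum_mono])
    fix r :: "'n \<times> 6"
    obtain i k where r: "r = (i, k)" by (cases r)
    have "\<bar>\<Sum>j\<in>UNIV. \<phi>' j t $ k\<bar> \<le> (\<Sum>j\<in>UNIV. \<bar>\<phi>' j t $ k\<bar>)" by (rule sum_abs)
    also have "\<dots> \<le> ?N * \<gamma>"
      by (rule sum_bounded_above) (rule \<phi>'_bound[OF that])
    finally have "\<bar>\<Sum>j\<in>UNIV. \<phi>' j t $ k\<bar> \<le> ?N * \<gamma>" .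
    then have "\<bar>mean (\<lambda>j. \<phi>' j t) $ k\<bar> \<le> \<gamma>"
      by (simp add: mean_def abs_mult divide_simps mult.commute)
    moreover have "\<Psi>' t $ r = \<phi>' i t $ k - mean (\<lambda>j. \<phi>' j t) $ k"
      by (simp add: r \<Psi>'_def stack_def kron_vec_def)
    ultimately show "\<bar>\<Psi>' t $ r\<bar> \<le> 2 * \<gamma>"
      using \<phi>'_bound[OF that, of i k] by linarith
  qed
  have split: "x_err t = w t + \<Psi> t" if "t \<ge> t0" for t
    using that by (simp add: x_err x \<Phi> \<phi>bar \<Psi>_def mean_def)
  obtain E where "negligible E" and E: "\<And>t. \<lbrakk>t \<ge> t0; t \<notin> E\<rbrakk> \<Longrightarrow>
      \<exists>u\<in>filippov_map (consensus_rhs G \<beta> \<Phi>) t (w t). (w has_vector_derivative u) (at t within {t0..})"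
    using filippov_solutionE[OF w] by metis
  have sum_zero: "(\<Sum>i\<in>UNIV. x_err t $ (i, k)) = 0" if "t \<ge> t0" for t k
  proof -
    (* The consensus direction that selects component k lies in the kernel of the arc differences. *)
    have "kron_vec (vec 1) (axis k 1) \<bullet> w t = kron_vec (vec 1) (axis k 1) \<bullet> w t0"
      using filippov_solution_conserves[OF w _ that] filippov_consensus_conserves
        edge_difference_consensus[OF graph(1,3)] by metis
    then have "(\<Sum>m\<in>UNIV. axis k 1 $ m * (\<Sum>i\<in>UNIV. w t $ (i, m))) = 0"
      unfolding inner_kron_vec_ones[symmetric] init by (simp add: inner_commute)
    then have "(\<Sum>i\<in>UNIV. w t $ (i, k)) = 0"
      by (simp add: axis_def if_distrib[where f="\<lambda>a. a * _"] cong: if_cong)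
    then show ?thesis
      by (simp add: split[OF that] \<Psi>_def mean_def stack_def kron_vec_def sum.distrib sum_subtractf)
  qed
  have "x_err t = 0" if "t \<ge> t0 + norm (x_err t0) / ?L" for t
  proof (rule finite_time_extinction[where X = x_err, OF _ \<open>negligible E\<close> pos _ that])
    fix T assume "T \<ge> t0"
    show "absolutely_continuous_on {t0..T} x_err"
    proof (rule absolutely_continuous_on_bounded_increments[where f = w and S = "{t0..T}" and C = 1
          and B = "\<Sum>r\<in>(UNIV :: ('n \<times> 6) set). 2 * \<gamma>"])
      show "absolutely_continuous_on {t0..T} w" using w \<open>T \<ge> t0\<close> by (simp add: filippov_solution_def)
      show "0 \<le> (\<Sum>r\<in>(UNIV :: ('n \<times> 6) set). 2 * \<gamma>)" using \<gamma>_pos by simp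
      fix a b assume ab: "a \<in> {t0..T}" "b \<in> {t0..T}" "a \<le> b"
      have "norm (\<Psi> b - \<Psi> a) \<le> (\<Sum>r\<in>(UNIV :: ('n \<times> 6) set). 2 * \<gamma>) * (b - a)"
        by (rule norm_increment_le[of "{t0..}" \<Psi> \<Psi>']) (use ab \<Psi>_deriv \<Psi>'_bound in auto)
      then show "norm (x_err b - x_err a)
          \<le> 1 * norm (w b - w a) + (\<Sum>r\<in>(UNIV :: ('n \<times> 6) set). 2 * \<gamma>) * (b - a)"
        using norm_triangle_ineq[of "w b - w a" "\<Psi> b - \<Psi> a"] ab by (simp add: split algebra_simps)
    qed auto
  next
    fix t assume t: "t \<ge> t0" "t \<notin> E"
    then obtain u where u: "u \<in> filippov_map (consensus_rhs G \<beta> \<Phi>) t (w t)"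
      "(w has_vector_derivative u) (at t within {t0..})"
      using E by blast
    have "((\<lambda>t. w t + \<Psi> t) has_vector_derivative u + \<Psi>' t) (at t within {t0..})"
      by (intro has_vector_derivative_add u(2) \<Psi>_deriv t(1))
    then have "(x_err has_vector_derivative u + \<Psi>' t) (at t within {t0..})"
      by (rule has_vector_derivative_transform[rotated 2]) (use t split in auto)
    moreover have "x_err t \<bullet> (u + \<Psi>' t) \<le> - ?L * norm (x_err t)"
      unfolding \<Psi>'_def
      by (rule consensus_error_dissipation[OF order graph conn pos u(1) _ sum_zero[OF t(1)] \<phi>'_bound[OF t(1)] gain'])
        (simp add: x_err x t(1))
    ultimately show "\<exists>X'. (x_err has_vector_derivative X') (at t within {t0..})
        \<and> x_err t \<bullet> X' \<le> - ?L * norm (x_err t)"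
      by blast
  qed
  then show ?thesis by blast
qed

end
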